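(* Let $M$ be a manifold (not necessarily compact) with a volume form $\omega$, and let $f:M\to M$ be a $\mathcal{C}^1$-diffeomorphism preserving $\omega$. Let $U\subseteq M$ be an attractor block for $f$ and let $A$ be the attractor determined by $U$. Then the complement in $U-A$ of the set of points $p\in U-A$ with unbounded orbit $\{f^n(p): n\ge 0\}$ has measure $0$.
   Context: $M$ is an $n$-dimensional differentiable manifold with a metric $d$ inducing its topology, such that closed balls of finite radius are compact (hence of finite measure). A volume form is a nowhere vanishing $n$-form; $f$ preserves $\omega$ if $f^*\omega=\omega$. Measure means the Lebesgue measure $m$ on $M$ defined by integrating $\omega$ (i.e., the volume measure associated with $\omega$). Bounded means bounded with respect to $d$. An attractor block (weakly absorbing set) for $f$ is a nonempty open set $U\subseteq M$ for which there is a continuous function $\varepsilon:M\to(0,\infty)$ such that the closed ball of radius $\varepsilon(f(x))$ centered at $f(x)$ is contained in $U$ for each $x\in U$. The (weak) attractor determined by $U$ is $A=\bigcap_{n\ge 0}\overline{f^n(U)}$. *)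

theory Defs
  imports "HOL-Analysis.Analysis"
begin

text \<open>
  The manifold \<open>M\<close> is the whole of a type of class \<^class>\<open>metric_space\<close>, whose distance is the metric
  \<open>d\<close> inducing the topology; the dimension is \<open>n = CARD('n)\<close>. The differentiable structure is given
  by an atlas of class C1. A C-infinity atlas is in particular such an atlas, and whether a map
  is a C1 diffeomorphism does not depend on which of the two structures one looks at.
\<close>

type_synonym ('a, 'n) chart = "'a set \<times> ('a \<Rightarrow> real ^ 'n)"

abbreviation chart_dom :: "('a, 'n) chart \<Rightarrow> 'a set" where
  "chart_dom \<equiv> fst"

abbreviation chart_map :: "('a, 'n) chart \<Rightarrow> 'a \<Rightarrow> real ^ 'n" where
  "chart_map \<equiv> snd"

definition chart_inv :: "('a, 'n) chart \<Rightarrow> real ^ 'n \<Rightarrow> 'a" where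
  "chart_inv c = inv_into (chart_dom c) (chart_map c)"

definition is_chart :: "('a::topological_space, 'n::finite) chart \<Rightarrow> bool" where
  "is_chart c \<longleftrightarrow> open (chart_dom c) \<and> open (chart_map c ` chart_dom c) \<and>
     homeomorphism (chart_dom c) (chart_map c ` chart_dom c) (chart_map c) (chart_inv c)"

definition C1_on :: "'e::real_normed_vector set \<Rightarrow> ('e \<Rightarrow> 'f::real_normed_vector) \<Rightarrow> bool" where
  "C1_on S g \<longleftrightarrow> (\<exists>g'. (\<forall>x\<in>S. (g has_derivative blinfun_apply (g' x)) (at x)) \<and> continuous_on S g')"

definition local_rep :: "('a \<Rightarrow> 'a) \<Rightarrow> ('a, 'n) chart \<Rightarrow> ('a, 'n) chart \<Rightarrow> real ^ 'n \<Rightarrow> real ^ 'n" where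
  "local_rep f c c' = chart_map c' \<circ> f \<circ> chart_inv c"

text \<open>The transition map from \<open>c\<close> to \<open>c'\<close> is \<open>local_rep id c c'\<close>.\<close>

definition C1_atlas :: "('a::topological_space, 'n::finite) chart set \<Rightarrow> bool" where
  "C1_atlas \<A> \<longleftrightarrow> (\<forall>c\<in>\<A>. is_chart c) \<and> (\<Union>c\<in>\<A>. chart_dom c) = UNIV \<and>
     (\<forall>c\<in>\<A>. \<forall>c'\<in>\<A>. C1_on (chart_map c ` (chart_dom c \<inter> chart_dom c')) (local_rep id c c'))"

definition C1_map :: "('a::topological_space, 'n::finite) chart set \<Rightarrow> ('a \<Rightarrow> 'a) \<Rightarrow> bool" where
  "C1_map \<A> f \<longleftrightarrow> continuous_on UNIV f \<and>
     (\<forall>c\<in>\<A>. \<forall>c'\<in>\<A>. C1_on (chart_map c ` (chart_dom c \<inter> f -` chart_dom c')) (local_rep f c c'))"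

definition C1_diffeomorphism :: "('a::topological_space, 'n::finite) chart set \<Rightarrow> ('a \<Rightarrow> 'a) \<Rightarrow> bool" where
  "C1_diffeomorphism \<A> f \<longleftrightarrow> bij f \<and> C1_map \<A> f \<and> C1_map \<A> (inv f)"

text \<open>
  Forms of degree \<open>CARD('k)\<close> on a vector space, the arguments being indexed by \<open>'k\<close>.
\<close>

definition alternating_form :: "(('k \<Rightarrow> 'v::real_vector) \<Rightarrow> real) \<Rightarrow> bool" where
  "alternating_form \<alpha> \<longleftrightarrow> (\<forall>v i. linear (\<lambda>x. \<alpha> (v(i := x)))) \<and>
     (\<forall>v i j. i \<noteq> j \<longrightarrow> v i = v j \<longrightarrow> \<alpha> v = 0)"

text \<open>
  A differential form of degree \<open>n = CARD('n)\<close> is given by its local expressions: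
  \<open>\<omega> c p\<close> is the alternating form at \<open>p\<close>, for \<open>p\<close> in the domain of \<open>c\<close>, where the tangent space at
  \<open>p\<close> is identified with \<open>real ^ 'n\<close> by the derivative of the chart \<open>c\<close>. Local expressions
  in two charts have to be related by the derivative of the transition map.
\<close>

type_synonym ('a, 'n) nform = "('a, 'n) chart \<Rightarrow> 'a \<Rightarrow> ('n \<Rightarrow> real ^ 'n) \<Rightarrow> real"

text \<open>
  The expression at \<open>p\<close> of the pullback of \<open>\<omega>\<close> by \<open>f\<close> in the chart \<open>c\<close>, computed from the
  expression of \<open>\<omega>\<close> at \<open>f p\<close> in the chart \<open>c'\<close>.
\<close>

definition pullback_rep ::
  "('a \<Rightarrow> 'a) \<Rightarrow> ('a, 'n::finite) nform \<Rightarrow> ('a, 'n) chart \<Rightarrow> ('a, 'n) chart \<Rightarrow> 'a \<Rightarrow> ('n \<Rightarrow> real ^ 'n) \<Rightarrow> real"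
  where
  "pullback_rep f \<omega> c c' p v =
     \<omega> c' (f p) (\<lambda>i. frechet_derivative (local_rep f c c') (at (chart_map c p)) (v i))"

definition is_nform :: "('a::topological_space, 'n::finite) chart set \<Rightarrow> ('a, 'n) nform \<Rightarrow> bool" where
  "is_nform \<A> \<omega> \<longleftrightarrow>
     (\<forall>c\<in>\<A>. \<forall>p\<in>chart_dom c. alternating_form (\<omega> c p)) \<and>
     (\<forall>c\<in>\<A>. \<forall>v. continuous_on (chart_dom c) (\<lambda>p. \<omega> c p v)) \<and>
     (\<forall>c\<in>\<A>. \<forall>c'\<in>\<A>. \<forall>p\<in>chart_dom c \<inter> chart_dom c'. \<omega> c p = pullback_rep id \<omega> c c' p)"

definition volume_form :: "('a::topological_space, 'n::finite) chart set \<Rightarrow> ('a, 'n) nform \<Rightarrow> bool" where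
  "volume_form \<A> \<omega> \<longleftrightarrow> is_nform \<A> \<omega> \<and> (\<forall>c\<in>\<A>. \<forall>p\<in>chart_dom c. \<omega> c p \<noteq> (\<lambda>v. 0))"

definition preserves_form :: "('a::topological_space, 'n::finite) chart set \<Rightarrow> ('a \<Rightarrow> 'a) \<Rightarrow> ('a, 'n) nform \<Rightarrow> bool"
  where
  "preserves_form \<A> f \<omega> \<longleftrightarrow>
     (\<forall>c\<in>\<A>. \<forall>c'\<in>\<A>. \<forall>p\<in>chart_dom c \<inter> f -` chart_dom c'. pullback_rep f \<omega> c c' p = \<omega> c p)"

text \<open>
  The Borel measure whose restriction to the domain of each chart is integration of the absolute
  value of \<open>\<omega>\<close>, evaluated on the coordinate vector fields, against Lebesgue measure in coordinates
  (absolute value, because charts need not be compatible with the orientation given by \<open>\<omega>\<close>).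
  It exists and is unique when the topology is second countable, which follows from
  compactness of the closed balls. The Lebesgue measure is its completion.
\<close>

definition borel_volume_measure ::
  "('a::topological_space, 'n::finite) chart set \<Rightarrow> ('a, 'n) nform \<Rightarrow> 'a measure" where
  "borel_volume_measure \<A> \<omega> = (THE \<mu>. sets \<mu> = sets borel \<and>
     (\<forall>c\<in>\<A>. \<forall>B\<in>sets borel. B \<subseteq> chart_dom c \<longrightarrow>
        emeasure \<mu> B =
          (\<integral>\<^sup>+y\<in>chart_map c ` B. ennreal \<bar>\<omega> c (chart_inv c y) (\<lambda>i. axis i 1)\<bar> \<partial>lborel)))"

definition volume_measure ::
  "('a::topological_space, 'n::finite) chart set \<Rightarrow> ('a, 'n) nform \<Rightarrow> 'a measure" where
  "volume_measure \<A> \<omega> = completion (borel_volume_measure \<A> \<omega>)"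

definition attractor_block :: "('a::metric_space \<Rightarrow> 'a) \<Rightarrow> 'a set \<Rightarrow> bool" where
  "attractor_block f U \<longleftrightarrow> U \<noteq> {} \<and> open U \<and>
     (\<exists>\<epsilon>::'a \<Rightarrow> real. continuous_on UNIV \<epsilon> \<and> (\<forall>x. \<epsilon> x > 0) \<and>
        (\<forall>x\<in>U. cball (f x) (\<epsilon> (f x)) \<subseteq> U))"

definition attractor :: "('a::topological_space \<Rightarrow> 'a) \<Rightarrow> 'a set \<Rightarrow> 'a set" where
  "attractor f U = (\<Inter>n. closure ((f ^^ n) ` U))"

definition forward_orbit :: "('a \<Rightarrow> 'a) \<Rightarrow> 'a \<Rightarrow> 'a set" where
  "forward_orbit f p = {(f ^^ n) p | n. True}"

end

theory Submission
  imports Defs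
begin

text \<open>
Put \<open>W = U - f ` U\<close>. An attractor block is mapped well inside itself: \<open>closure (f ` U) \<subseteq> U\<close>
(\<open>attractor_block_closure_image\<close>). Since \<open>f\<close> is a homeomorphism, the closures in the definition of
the attractor can therefore be dropped, \<open>A\<close> is the intersection of the decreasing sequence of the
sets \<open>(f ^^ n) ` U\<close>, and \<open>U - A\<close> is the disjoint union of its successive differences
\<open>(f ^^ n) ` W\<close>. Let \<open>E\<close> consist of the points of one such layer whose whole forward orbit stays in
a closed ball \<open>K\<close>. The sets \<open>(f ^^ k) ` E\<close> lie in different layers, so they are disjoint; they lie
in \<open>K\<close>, which is compact and so has finite measure; and they all have the measure of \<open>E\<close>, because
\<open>f\<close> preserves the form. Hence \<open>E\<close> is a null set (\<open>wandering_set_confined_null\<close>). There are countably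
many layers, and a bounded orbit stays in one of countably many balls about a fixed point, so the
points of \<open>U - A\<close> with bounded orbit form a null set (\<open>bounded_orbit_wandering_null\<close>).

This uses three properties of the measure: it exists at all, it is invariant under \<open>f\<close>, and
it is finite on compact sets. The first two come from one computation, \<open>chart_integral_image\<close>: the
integral of the form over \<open>B\<close> in one chart equals its integral over \<open>f ` B\<close> in another chart. With
\<open>f = id\<close> this is independence of the chart, which makes it possible to glue the
measure from countably many charts (\<open>volume_measure_exists\<close>), and for a diffeomorphism that
preserves the form it is invariance (\<open>emeasure_volume_image\<close>). The computation itself combines two facts:
applying a linear map to the basis vectors multiplies the value of a form of top degree by the
determinant (\<open>alternating_form_linear_image_basis\<close>), and the change of variables formula.

The change of variables formula \<open>has_absolute_integral_change_of_variables\<close> concerns spaces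
\<open>real ^ 'm\<close> whose index type is well-ordered. An arbitrary finite index type is therefore replaced by a copy
that carries an order; this is a relabelling of coordinates, which changes neither
Lebesgue measure nor determinants.
\<close>

section \<open>Alternating forms and determinants\<close>

lemma alternating_form_linear:
  "alternating_form \<alpha> \<Longrightarrow> linear (\<lambda>x. \<alpha> (v(i := x)))"
  by (simp add: alternating_form_def)

lemma alternating_form_eq_0:
  "alternating_form \<alpha> \<Longrightarrow> i \<noteq> j \<Longrightarrow> v i = v j \<Longrightarrow> \<alpha> v = 0"
  unfolding alternating_form_def by blast

text \<open>
Together with the two lemmas after it, this describes how an alternating form reacts to the
elementary row operations, which is how the determinant enters.
\<close>

lemma alternating_form_add_multiple:
  assumes "alternating_form \<alpha>" "i \<noteq> j"
  shows "\<alpha> (v(i := v i + c *\<^sub>R v j)) = \<alpha> v"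
proof -
  note lin = alternating_form_linear[OF assms(1), of v i]
  have "\<alpha> (v(i := v i + c *\<^sub>R v j)) = \<alpha> (v(i := v i)) + c * \<alpha> (v(i := v j))"
    using linear_add[OF lin] linear_scale[OF lin] by simp
  also have "\<alpha> (v(i := v j)) = 0"
    using assms by (intro alternating_form_eq_0[of \<alpha> i j]) auto
  finally show ?thesis by (simp del: fun_upd_apply add: fun_upd_triv)
qed

lemma alternating_form_swap:
  assumes "alternating_form \<alpha>" "i \<noteq> j"
  shows "\<alpha> (v \<circ> Transposition.transpose i j) = - \<alpha> v"
proof -
  let ?w = "\<lambda>x y. v(i := x, j := y)"
  have li: "linear (\<lambda>x. \<alpha> (?w x y))" for y
    using alternating_form_linear[OF assms(1), of "v(j := y)" i] assms(2)
    by (simp add: fun_upd_twist)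
  have lj: "linear (\<lambda>y. \<alpha> (?w x y))" for x
    by (rule alternating_form_linear[OF assms(1)])
  have 0: "\<alpha> (?w x x) = 0" for x
    using assms by (intro alternating_form_eq_0[of \<alpha> i j]) auto
  \<comment> \<open>Polarisation: the form vanishes when the arguments at \<open>i\<close> and \<open>j\<close> are both \<open>v i + v j\<close>.\<close>
  have "\<alpha> (?w (v i + v j) (v i + v j)) = \<alpha> (?w (v i) (v i)) + \<alpha> (?w (v i) (v j))
     + \<alpha> (?w (v j) (v i)) + \<alpha> (?w (v j) (v j))"
    using linear_add[OF li] linear_add[OF lj] by simp
  then have "\<alpha> (?w (v j) (v i)) = - \<alpha> (?w (v i) (v j))"
    unfolding 0 by linarith
  moreover have "?w (v i) (v j) = v"
    by auto
  moreover have "?w (v j) (v i) = v \<circ> Transposition.transpose i j"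
    by (auto simp: Transposition.transpose_def fun_eq_iff)
  ultimately show ?thesis by simp
qed

text \<open>
The effect of a diagonal matrix, obtained by rescaling one argument at a time.
\<close>

lemma alternating_form_scale_all:
  assumes "alternating_form \<alpha>" 
  shows "\<alpha> (\<lambda>i. c i *\<^sub>R v i) = (\<Prod>i\<in>UNIV. c i) * \<alpha> (v :: 'n::finite \<Rightarrow> _)"
proof -
  have "\<alpha> (\<lambda>i. if i \<in> S then c i *\<^sub>R v i else v i) = (\<Prod>i\<in>S. c i) * \<alpha> v" if "finite S" for S
    using that
  proof (induction S)
    case (insert k S)
    let ?w = "\<lambda>i. if i \<in> S then c i *\<^sub>R v i else v i"
    have "(\<lambda>i. if i \<in> insert k S then c i *\<^sub>R v i else v i) = ?w(k := c k *\<^sub>R ?w k)"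
      using insert.hyps by auto
    then have "\<alpha> (\<lambda>i. if i \<in> insert k S then c i *\<^sub>R v i else v i) = c k * \<alpha> (?w(k := ?w k))"
      using linear_scale[OF alternating_form_linear[OF assms, of ?w k], of "c k" "?w k"] by simp
    also have "?w(k := ?w k) = ?w"
      by auto
    finally show ?case
      using insert by simp
  qed simp
  from this[of UNIV] show ?thesis by simp
qed

text \<open>
Both sides are multiplicative in \<open>A\<close>, so it is enough to compare them on the elementary matrices
that generate all square matrices. Letting \<open>v\<close> vary in the induction is what makes the case of a product work.
\<close>

lemma alternating_form_matrix:
  fixes A :: "real ^ 'n ^ 'n"
  assumes "alternating_form \<alpha>"
  shows "\<alpha> (\<lambda>i. \<Sum>j\<in>UNIV. A $ i $ j *\<^sub>R v j) = det A * \<alpha> v"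
proof (induction A arbitrary: v rule: induct_matrix_elementary_alt)
  case (1 A B)
  have "(\<Sum>j\<in>UNIV. (A ** B) $ i $ j *\<^sub>R v j) = (\<Sum>k\<in>UNIV. A $ i $ k *\<^sub>R (\<Sum>j\<in>UNIV. B $ k $ j *\<^sub>R v j))" for i
    unfolding matrix_matrix_mult_def
    by (simp add: scaleR_sum_left scaleR_sum_right) (rule sum.swap)
  then show ?case
    by (simp add: 1 det_mul)
next
  case (2 A i)
  let ?w = "\<lambda>i. \<Sum>j\<in>UNIV. A $ i $ j *\<^sub>R v j"
  have "?w i = 0"
    using 2 by (simp add: row_def vec_eq_iff)
  then have "?w = ?w(i := 0)"
    by auto
  then have "\<alpha> ?w = 0"
    using linear_0[OF alternating_form_linear[OF assms, of ?w i]] by metis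
  then show ?case
    using det_zero_row(1)[OF 2] by simp
next
  case (3 A)
  have "(\<Sum>j\<in>UNIV. A $ i $ j *\<^sub>R v j) = A $ i $ i *\<^sub>R v i" for i
    using sum.remove[of UNIV i "\<lambda>j. A $ i $ j *\<^sub>R v j"] 3 by (simp add: sum.neutral)
  then show ?case
    using alternating_form_scale_all[OF assms, of "\<lambda>i. A $ i $ i" v] det_diagonal[OF 3] by simp
next
  case (4 m n)
  let ?A = "\<chi> i j. mat 1 $ i $ Transposition.transpose m n j :: real ^ 'n ^ 'n"
  have "?A $ i $ j = (if j = Transposition.transpose m n i then 1 else 0)" for i j
    by (auto simp: mat_def)
  then have "(\<lambda>i. \<Sum>j\<in>UNIV. ?A $ i $ j *\<^sub>R v j) = v \<circ> Transposition.transpose m n"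
    by (simp add: fun_eq_iff if_distrib[of "\<lambda>x. x *\<^sub>R _"] cong: if_cong)
  moreover have "det ?A = - 1"
    using det_permute_columns[OF permutes_swap_id[of m UNIV n], of "mat 1"] 4
    by (simp add: sign_swap_id)
  ultimately show ?case
    using alternating_form_swap[OF assms 4, of v] by simp
next
  case (5 m n)
  let ?A = "\<chi> i j. of_bool (i = m \<and> j = n \<or> i = j) :: real ^ 'n ^ 'n"
  have "(\<Sum>j\<in>UNIV. ?A $ i $ j *\<^sub>R v j) = (v(m := v m + 1 *\<^sub>R v n)) i" for i
  proof -
    have "(\<Sum>j\<in>UNIV. ?A $ i $ j *\<^sub>R v j)
       = (\<Sum>j\<in>UNIV. (if j = i then v j else 0) + (if j = n then if i = m then v j else 0 else 0))"
      using 5 by (intro sum.cong) auto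
    then show ?thesis
      by (simp add: sum.distrib)
  qed
  then have "(\<lambda>i. \<Sum>j\<in>UNIV. ?A $ i $ j *\<^sub>R v j) = v(m := v m + 1 *\<^sub>R v n)"
    by (rule ext)
  moreover have "det ?A = 1"
  proof -
    have "?A = (\<chi> k. if k = m then row m (mat 1) + 1 *s row n (mat 1) else row k (mat 1))"
      using 5 by (auto simp: vec_eq_iff row_def mat_def)
    then show ?thesis
      using det_row_operation[OF 5, of "mat 1 :: real ^ 'n ^ 'n" 1] by simp
  qed
  ultimately show ?case
    using alternating_form_add_multiple[OF assms 5, of v 1] by simp
qed

text \<open>
The matrix of \<open>L\<close> has the images of the basis vectors as its columns, while the preceding lemma
combines the arguments along rows; the transpose in between does not change the determinant.
\<close>

lemma alternating_form_linear_image_basis: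
  fixes L :: "real ^ 'n \<Rightarrow> real ^ 'n"
  assumes "alternating_form \<alpha>" 
  shows "\<alpha> (\<lambda>i. L (axis i 1)) = det (matrix L) * \<alpha> (\<lambda>i. axis i 1)"
proof -
  have "(\<Sum>j\<in>UNIV. transpose (matrix L) $ i $ j *\<^sub>R axis j 1) = L (axis i 1)" for i
    by (simp add: transpose_def matrix_def basis_expansion scalar_mult_eq_scaleR[symmetric])
  then show ?thesis
    using alternating_form_matrix[OF assms, of "transpose (matrix L)" "\<lambda>j. axis j 1"]
    by (simp add: det_transpose)
qed

section \<open>Change of variables over an arbitrary finite index type\<close>

text \<open>
A copy of the index type, which is free to receive an order even when \<open>'n\<close> already
carries another one.
\<close>

datatype 'n ordered_index = Ordered (unordered: 'n)

instance ordered_index :: (finite) finite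
proof
  have "range Ordered = (UNIV :: 'a ordered_index set)"
    by (metis ordered_index.exhaust surjI)
  then show "finite (UNIV :: 'a ordered_index set)"
    by (metis finite finite_imageI)
qed

instantiation ordered_index :: (countable) wellorder
begin

definition less_eq_ordered_index where
  "i \<le> j \<longleftrightarrow> to_nat (unordered i) \<le> to_nat (unordered j)"

definition less_ordered_index where
  "i < j \<longleftrightarrow> to_nat (unordered i) < to_nat (unordered j)"

instance
proof
  fix i j k :: "'a ordered_index"
  show "i < j \<longleftrightarrow> i \<le> j \<and> \<not> j \<le> i" "i \<le> i" "i \<le> j \<or> j \<le> i"
    by (auto simp: less_eq_ordered_index_def less_ordered_index_def)
  show "i \<le> j \<Longrightarrow> j \<le> k \<Longrightarrow> i \<le> k"
    by (auto simp: less_eq_ordered_index_def)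
  show "i \<le> j \<Longrightarrow> j \<le> i \<Longrightarrow> i = j"
    by (auto simp: less_eq_ordered_index_def intro: ordered_index.expand)
next
  fix P :: "'a ordered_index \<Rightarrow> bool" and i :: "'a ordered_index"
  assume *: "\<And>i. (\<And>j. j < i \<Longrightarrow> P j) \<Longrightarrow> P i"
  show "P i"
    by (induction i rule: measure_induct_rule[of "\<lambda>i. to_nat (unordered i)"])
       (auto intro: * simp: less_ordered_index_def)
qed

end

lemma all_ordered_index: "(\<forall>i. P i) \<longleftrightarrow> (\<forall>i. P (Ordered i))"
  by (metis ordered_index.collapse)

lemma bij_unordered: "bij unordered"
  by (metis bijI' ordered_index.expand ordered_index.sel)

definition reindex :: "real ^ 'n::finite \<Rightarrow> real ^ 'n ordered_index" where
  "reindex x = (\<chi> i. x $ unordered i)"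

definition unreindex :: "real ^ 'n ordered_index \<Rightarrow> real ^ 'n::finite" where
  "unreindex y = (\<chi> i. y $ Ordered i)"

lemma unreindex_reindex [simp]: "unreindex (reindex x) = x"
  by (simp add: reindex_def unreindex_def vec_eq_iff)

lemma reindex_unreindex [simp]: "reindex (unreindex x) = x"
  by (simp add: reindex_def unreindex_def vec_eq_iff)

lemma bounded_linear_reindex: "bounded_linear reindex"
  by (rule linear_conv_bounded_linear[THEN iffD1], rule linearI) (auto simp: reindex_def vec_eq_iff)

lemma unreindex_add: "unreindex (x + y) = unreindex x + unreindex y"
  by (simp add: unreindex_def vec_eq_iff)

lemma unreindex_scaleR: "unreindex (c *\<^sub>R x) = c *\<^sub>R unreindex x"
  by (simp add: unreindex_def vec_eq_iff)

lemma bounded_linear_unreindex: "bounded_linear unreindex"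
  by (rule linear_conv_bounded_linear[THEN iffD1], rule linearI) (auto simp: unreindex_def vec_eq_iff)

lemma borel_measurable_unreindex [measurable]: "unreindex \<in> borel \<rightarrow>\<^sub>M borel"
  by (intro borel_measurable_continuous_onI linear_continuous_on bounded_linear_unreindex)

lemma prod_Basis_cart: "(\<Prod>b\<in>(Basis :: (real ^ 'n::finite) set). f b) = (\<Prod>i\<in>UNIV. f (axis i 1))"
proof -
  have 1: "(Basis :: (real ^ 'n) set) = range (\<lambda>i. axis i 1)"
    by (auto simp: Basis_vec_def)
  have 2: "inj (\<lambda>i::'n. axis i (1::real))"
    by (auto simp: inj_def axis_eq_axis)
  show ?thesis
    unfolding 1 prod.reindex[OF 2] by simp
qed

text \<open>
Relabelling the coordinates permutes the sides of a box and so preserves its volume.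
\<close>

lemma distr_lborel_unreindex:
  "distr lborel borel unreindex = (lborel :: (real ^ 'n::finite) measure)"
proof (rule lborel_eqI[symmetric])
  fix l u :: "real ^ 'n"
  assume *: "\<And>b. b \<in> Basis \<Longrightarrow> l \<bullet> b \<le> u \<bullet> b"
  have le: "l $ i \<le> u $ i" for i
    using *[of "axis i 1"] by (auto simp: inner_axis axis_in_Basis_iff)
  have "unreindex -` box l u = box (reindex l) (reindex u)"
    by (auto simp: mem_box_cart reindex_def unreindex_def all_ordered_index)
  then have "emeasure (distr lborel borel unreindex) (box l u) = (\<Prod>b\<in>Basis. (reindex u - reindex l) \<bullet> b)"
    by (subst emeasure_distr) (auto simp: emeasure_lborel_box_eq Basis_vec_def inner_axis reindex_def le)
  also have "\<dots> = ennreal (\<Prod>i\<in>UNIV. u $ unordered i - l $ unordered i)"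
    by (simp add: prod_Basis_cart inner_axis reindex_def)
  also have "\<dots> = ennreal (\<Prod>i\<in>UNIV. u $ i - l $ i)"
    using prod.reindex_bij_betw[OF bij_unordered, of "\<lambda>i. u $ i - l $ i"] by simp
  finally show "emeasure (distr lborel borel unreindex) (box l u) = (\<Prod>b\<in>Basis. (u - l) \<bullet> b)"
    by (simp add: prod_Basis_cart inner_axis)
qed simp

lemma nn_integral_unreindex:
  assumes "h \<in> borel_measurable lborel"
  shows "(\<integral>\<^sup>+ y. h (unreindex y) \<partial>lborel) = (\<integral>\<^sup>+ x. h x \<partial>lborel)"
  using nn_integral_distr[of unreindex lborel borel h] assms
  by (simp add: distr_lborel_unreindex)

text \<open>
The determinant of the rows, read through the relabelling, is an alternating form on the relabelled
space. Evaluating it on the images of the basis vectors under the relabelled map produces both determinants.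
\<close>

lemma det_matrix_reindex:
  fixes L :: "real ^ 'n::finite \<Rightarrow> real ^ 'n"
  shows "det (matrix (reindex \<circ> L \<circ> unreindex)) = det (matrix L)"
proof -
  define \<alpha> :: "('n ordered_index \<Rightarrow> real ^ 'n ordered_index) \<Rightarrow> real"
    where "\<alpha> w = det (\<chi> i. unreindex (w (Ordered i)))" for w
  have "alternating_form \<alpha>"
    unfolding alternating_form_def
  proof safe
    fix w :: "'n ordered_index \<Rightarrow> real ^ 'n ordered_index" and i :: "'n ordered_index"
    obtain k where i: "i = Ordered k" by (cases i)
    have "(\<chi> m. unreindex ((w(i := x)) (Ordered m))) = 
      (\<chi> m. if m = k then unreindex x else unreindex (w (Ordered m)))" for x
      by (simp add: i vec_eq_iff)
    then show "linear (\<lambda>x. \<alpha> (w(i := x)))"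
      unfolding \<alpha>_def
      using det_row_add[of k "\<lambda>_. unreindex _" "\<lambda>_. unreindex _" "\<lambda>m. unreindex (w (Ordered m))"]
        det_row_mul[of k _ "\<lambda>_. unreindex _" "\<lambda>m. unreindex (w (Ordered m))"]
      by (intro linearI) (simp_all cong: if_cong add: unreindex_add unreindex_scaleR scalar_mult_eq_scaleR)
  next
    fix w :: "'n ordered_index \<Rightarrow> real ^ 'n ordered_index" and i j :: "'n ordered_index"
    assume "i \<noteq> j" "w i = w j"
    then show "\<alpha> w = 0"
      unfolding \<alpha>_def
      by (intro det_identical_rows[of "unordered i" "unordered j"])
         (auto simp: row_def ordered_index.expand)
  qed
  then have *: "\<alpha> (\<lambda>i. (reindex \<circ> L \<circ> unreindex) (axis i 1)) = 
      det (matrix (reindex \<circ> L \<circ> unreindex)) * \<alpha> (\<lambda>i. axis i 1)"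
    by (rule alternating_form_linear_image_basis)
  have ax: "unreindex (axis (Ordered i) 1) = axis i 1" for i :: 'n
    by (auto simp: unreindex_def axis_def vec_eq_iff)
  have "\<alpha> (\<lambda>i. axis i 1) = det (mat 1 :: real ^ 'n ^ 'n)"
    unfolding \<alpha>_def ax by (rule arg_cong[of _ _ det]) (auto simp: vec_eq_iff axis_def mat_def)
  moreover have "\<alpha> (\<lambda>i. (reindex \<circ> L \<circ> unreindex) (axis i 1)) = det (transpose (matrix L))"
    by (simp add: \<alpha>_def ax transpose_def matrix_def)
  ultimately show ?thesis
    using * by (simp add: det_transpose)
qed

text \<open>
The formula for absolutely integrable functions is an equivalence: one side is integrable
with integral \<open>r\<close> if and only if the other one is. For nonnegative functions this also covers the
case that both integrals are infinite.
\<close>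

lemma nn_integral_change_of_variables_wellorder:
  fixes g :: "real ^ 'm::{finite,wellorder} \<Rightarrow> real ^ 'm::{finite,wellorder}" and h :: "real ^ 'm::{finite,wellorder} \<Rightarrow> real"
  assumes S: "S \<in> sets borel" 
    and gS: "g ` S \<in> sets borel"
    and der: "\<And>x. x \<in> S \<Longrightarrow> (g has_derivative g' x) (at x within S)"
    and inj: "inj_on g S"
    and h: "(\<lambda>y. h y * indicator (g ` S) y) \<in> borel_measurable borel"
    and k: "(\<lambda>x. \<bar>det (matrix (g' x))\<bar> * h (g x) * indicator S x) \<in> borel_measurable borel"
    and nonneg: "\<And>y. 0 \<le> h y"
  shows "(\<integral>\<^sup>+ y\<in>g ` S. ennreal (h y) \<partial>lborel) = (\<integral>\<^sup>+ x\<in>S. ennreal (\<bar>det (matrix (g' x))\<bar> * h (g x)) \<partial>lborel)"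
proof -
  have nn: "(\<integral>\<^sup>+ y\<in>T. ennreal (u y) \<partial>lborel) = ennreal r \<longleftrightarrow> (u absolutely_integrable_on T \<and> integral T u = r)"
    if T: "T \<in> sets borel" and u: "(\<lambda>y. u y * indicator T y) \<in> borel_measurable borel" "\<And>y. 0 \<le> u y" 
      and r: "0 \<le> r"
    for T and u :: "real ^ 'm::{finite,wellorder} \<Rightarrow> real" and r
  proof -
    let ?u = "\<lambda>y. u y * indicator T y"
    have "(\<integral>\<^sup>+ y\<in>T. ennreal (u y) \<partial>lborel) = (\<integral>\<^sup>+ y. ennreal (?u y) \<partial>lebesgue)"
      unfolding nn_integral_completion by (intro nn_integral_cong) (auto simp: indicator_def)
    moreover have "?u \<in> borel_measurable lebesgue"
      using u(1) by (simp add: measurable_completion)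
    ultimately have "(\<integral>\<^sup>+ y\<in>T. ennreal (u y) \<partial>lborel) = ennreal r \<longleftrightarrow> (?u has_integral r) UNIV"
      using has_integral_iff_nn_integral_lebesgue[of ?u r] u(2) r by auto
    also have "\<dots> \<longleftrightarrow> (u has_integral r) T"
    proof -
      have "?u = (\<lambda>y. if y \<in> T then u y else 0)"
        by auto
      then show ?thesis
        using has_integral_restrict_UNIV[of T u r] by simp
    qed
    also have "\<dots> \<longleftrightarrow> (u absolutely_integrable_on T \<and> integral T u = r)"
      using u(2) by (auto simp: has_integral_iff absolutely_integrable_on_iff_nonneg)
    finally show ?thesis .
  qed
  let ?k = "\<lambda>x. \<bar>det (matrix (g' x))\<bar> * h (g x)"
  \<comment> \<open>The formula invoked below is for values in a space \<open>real ^ 'k\<close>, so real values are turned into vectors with one coordinate.\<close>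
  have vec: "u absolutely_integrable_on T \<and> integral T u = r \<longleftrightarrow> 
      (\<lambda>x. vec (u x) :: real ^ 1) absolutely_integrable_on T \<and> integral T (\<lambda>x. vec (u x) :: real ^ 1) = vec r"
    for T r and u :: "real ^ 'm::{finite,wellorder} \<Rightarrow> real"
    unfolding absolutely_integrable_on_1_iff
    by (auto simp: integral_on_1_eq absolutely_integrable_on_def)
  have eq: "(\<integral>\<^sup>+ y\<in>g ` S. ennreal (h y) \<partial>lborel) = ennreal r \<longleftrightarrow> (\<integral>\<^sup>+ x\<in>S. ennreal (?k x) \<partial>lborel) = ennreal r"
    if "0 \<le> r" for r
  proof -
    have "(\<integral>\<^sup>+ y\<in>g ` S. ennreal (h y) \<partial>lborel) = ennreal r \<longleftrightarrow> h absolutely_integrable_on (g ` S) \<and> integral (g ` S) h = r"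
      by (rule nn[OF gS h nonneg that])
    also have "\<dots> \<longleftrightarrow> ?k absolutely_integrable_on S \<and> integral S ?k = r"
      using has_absolute_integral_change_of_variables[of S g g' "\<lambda>x. vec (h x) :: real ^ 1" "vec r"] S der inj
      unfolding vec[where u=h] vec[where u="?k"] by (simp add: vec_def scaleR_vec_def)
    also have "\<dots> \<longleftrightarrow> (\<integral>\<^sup>+ x\<in>S. ennreal (?k x) \<partial>lborel) = ennreal r"
      using nn[OF S k _ that] nonneg by simp
    finally show ?thesis .
  qed
  have "a = b" if "\<And>r. 0 \<le> r \<Longrightarrow> a = ennreal r \<longleftrightarrow> b = ennreal r" for a b
  proof (cases a rule: ennreal_cases)
    case (real r)
    then show ?thesis using that[of r] by simp
  next
    case top
    then show ?thesis using that by (cases b rule: ennreal_cases) force+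
  qed
  from this[OF eq] show ?thesis .
qed

lemma nn_integral_change_of_variables:
  fixes g :: "real ^ 'n::finite \<Rightarrow> real ^ 'n" and h :: "real ^ 'n \<Rightarrow> real"
  assumes S: "S \<in> sets borel" 
    and gS: "g ` S \<in> sets borel"
    and der: "\<And>x. x \<in> S \<Longrightarrow> (g has_derivative g' x) (at x within S)"
    and inj: "inj_on g S"
    and h: "(\<lambda>y. h y * indicator (g ` S) y) \<in> borel_measurable borel"
    and k: "(\<lambda>x. \<bar>det (matrix (g' x))\<bar> * h (g x) * indicator S x) \<in> borel_measurable borel"
    and nonneg: "\<And>y. 0 \<le> h y"
  shows "(\<integral>\<^sup>+ y\<in>g ` S. ennreal (h y) \<partial>lborel) = (\<integral>\<^sup>+ x\<in>S. ennreal (\<bar>det (matrix (g' x))\<bar> * h (g x)) \<partial>lborel)"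
proof -
  let ?g = "reindex \<circ> g \<circ> unreindex" and ?T = "unreindex -` S"
  let ?k = "\<lambda>x. \<bar>det (matrix (g' x))\<bar> * h (g x)"
  have T: "?g ` ?T = unreindex -` (g ` S)"
  proof safe
    fix y s assume "unreindex y = g s" "s \<in> S"
    then have "y = ?g (reindex s)" "reindex s \<in> ?T"
      by (metis comp_apply reindex_unreindex unreindex_reindex) (use \<open>s \<in> S\<close> in simp)
    then show "y \<in> ?g ` ?T"
      by (rule image_eqI)
  qed auto
  have meas: "unreindex -` X \<in> sets borel" if "X \<in> sets borel" for X :: "(real ^ 'n) set"
    using measurable_sets_borel[OF borel_measurable_unreindex that] .
  have transfer: "(\<integral>\<^sup>+ y\<in>unreindex -` X. ennreal (u (unreindex y)) \<partial>lborel) = (\<integral>\<^sup>+ x\<in>X. ennreal (u x) \<partial>lborel)"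
    if "(\<lambda>x. u x * indicator X x) \<in> borel_measurable borel" for X :: "(real ^ 'n) set" and u
  proof -
    have "(\<integral>\<^sup>+ y\<in>unreindex -` X. ennreal (u (unreindex y)) \<partial>lborel)
       = (\<integral>\<^sup>+ y. ennreal (u (unreindex y) * indicator X (unreindex y)) \<partial>lborel)"
      by (intro nn_integral_cong) (auto simp: indicator_def)
    also have "\<dots> = (\<integral>\<^sup>+ y. ennreal (u y * indicator X y) \<partial>lborel)"
      using that by (intro nn_integral_unreindex) simp
    also have "\<dots> = (\<integral>\<^sup>+ x\<in>X. ennreal (u x) \<partial>lborel)"
      by (intro nn_integral_cong) (auto simp: indicator_def)
    finally show ?thesis .
  qed
  have "(\<integral>\<^sup>+ y\<in>g ` S. ennreal (h y) \<partial>lborel) = (\<integral>\<^sup>+ y\<in>?g ` ?T. ennreal (h (unreindex y)) \<partial>lborel)"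
    unfolding T using transfer[OF h] by simp
  also have "\<dots> = (\<integral>\<^sup>+ x\<in>?T. ennreal (\<bar>det (matrix (reindex \<circ> g' (unreindex x) \<circ> unreindex))\<bar>
       * h (unreindex (?g x))) \<partial>lborel)"
  proof (rule nn_integral_change_of_variables_wellorder)
    show "?T \<in> sets borel" "?g ` ?T \<in> sets borel"
      using meas S gS by (auto simp only: T)
    show "inj_on ?g ?T"
      using inj by (auto simp: inj_on_def) (metis reindex_unreindex unreindex_reindex)
    show "(\<lambda>y. h (unreindex y) * indicator (?g ` ?T) y) \<in> borel_measurable borel"
      using measurable_compose[OF borel_measurable_unreindex h] 
      unfolding T by (simp add: indicator_def)
    show "(\<lambda>x. \<bar>det (matrix (reindex \<circ> g' (unreindex x) \<circ> unreindex))\<bar> * h (unreindex (?g x)) * indicator ?T x)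
        \<in> borel_measurable borel"
      using measurable_compose[OF borel_measurable_unreindex k] 
      by (simp add: indicator_def det_matrix_reindex)
    fix x assume "x \<in> ?T"
    then have "(g has_derivative g' (unreindex x)) (at (unreindex x) within unreindex ` ?T)"
      by (intro has_derivative_subset[OF der]) auto
    then have "(g \<circ> unreindex has_derivative g' (unreindex x) \<circ> unreindex) (at x within ?T)"
      by (rule diff_chain_within[OF bounded_linear_imp_has_derivative[OF bounded_linear_unreindex]])
    from diff_chain_within[OF this bounded_linear_imp_has_derivative[OF bounded_linear_reindex]]
    show "(?g has_derivative reindex \<circ> g' (unreindex x) \<circ> unreindex) (at x within ?T)"
      by (simp add: comp_assoc)
  qed (use nonneg in auto)
  also have "\<dots> = (\<integral>\<^sup>+ x\<in>S. ennreal (?k x) \<partial>lborel)"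
    using transfer[OF k] by (simp add: det_matrix_reindex)
  finally show ?thesis .
qed

section \<open>Integrating a form in a chart\<close>

text \<open>
The absolute value of the coefficient of the form with respect to \<open>dx\<^sub>1 \<and> \<dots> \<and> dx\<^sub>n\<close> in the chart.
\<close>

definition chart_density :: "('a, 'n::finite) nform \<Rightarrow> ('a, 'n) chart \<Rightarrow> real ^ 'n \<Rightarrow> real" where
  "chart_density \<omega> c y = \<bar>\<omega> c (chart_inv c y) (\<lambda>i. axis i 1)\<bar>"

definition chart_integral :: "('a, 'n::finite) nform \<Rightarrow> ('a, 'n) chart \<Rightarrow> 'a set \<Rightarrow> ennreal" where
  "chart_integral \<omega> c B = (\<integral>\<^sup>+ y\<in>chart_map c ` B. ennreal (chart_density \<omega> c y) \<partial>lborel)"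

lemma chart_inv_chart_map:
  "is_chart c \<Longrightarrow> p \<in> chart_dom c \<Longrightarrow> chart_inv c (chart_map c p) = p"
  by (auto simp: is_chart_def homeomorphism_def)

lemma inj_on_chart_map: "is_chart c \<Longrightarrow> inj_on (chart_map c) (chart_dom c)"
  by (metis chart_inv_chart_map inj_on_inverseI)

lemma chart_image_eq_vimage:
  assumes "is_chart c" "B \<subseteq> chart_dom c"
  shows "chart_map c ` B = chart_inv c -` B \<inter> chart_map c ` chart_dom c"
  using chart_inv_chart_map[OF assms(1)] assms(2) by force

lemma borel_chart_image:
  fixes c :: "('a::topological_space, 'n::finite) chart"
  assumes c: "is_chart c" and B: "B \<in> sets borel" "B \<subseteq> chart_dom c"
  shows "chart_map c ` B \<in> sets borel"
proof -
  let ?V = "chart_map c ` chart_dom c"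
  have V: "?V \<in> sets borel"
    using c by (simp add: is_chart_def)
  have "chart_inv c \<in> borel_measurable (restrict_space borel ?V)"
    using c by (intro borel_measurable_continuous_on_restrict) (simp add: is_chart_def homeomorphism_def)
  from measurable_sets[OF this B(1)] have "chart_inv c -` B \<inter> ?V \<in> sets (restrict_space borel ?V)"
    by (simp add: space_restrict_space)
  then show ?thesis
    using V unfolding chart_image_eq_vimage[OF c B(2)] by (simp add: sets_restrict_space_iff)
qed

lemma borel_measurable_chart_density:
  fixes c :: "('a::topological_space, 'n::finite) chart"
  assumes c: "is_chart c" and \<omega>: "\<And>v. continuous_on (chart_dom c) (\<lambda>p. \<omega> c p v)"
    and X: "X \<in> sets borel" "X \<subseteq> chart_map c ` chart_dom c"
  shows "(\<lambda>y. chart_density \<omega> c y * indicator X y) \<in> borel_measurable borel"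
proof -
  have inv: "continuous_on (chart_map c ` chart_dom c) (chart_inv c)" 
     "chart_inv c ` chart_map c ` chart_dom c = chart_dom c"
    using c by (auto simp: is_chart_def homeomorphism_def)
  have "continuous_on X (chart_density \<omega> c)"
    unfolding chart_density_def
    by (intro continuous_on_rabs continuous_on_compose2[OF \<omega> continuous_on_subset[OF inv(1) X(2)]])
       (use inv(2) X(2) in blast)
  then show ?thesis
    using borel_measurable_continuous_on_indicator[OF X(1), of "chart_density \<omega> c"] by (simp add: mult.commute)
qed

text \<open>
The integral over \<open>B\<close> is the value of a measure with density on the image of \<open>B\<close>, and a chart, being
injective, maps disjoint sets to disjoint sets.
\<close>

lemma suminf_chart_integral:
  fixes c :: "('a::topological_space, 'n::finite) chart"
  assumes c: "is_chart c" and \<omega>: "\<And>v. continuous_on (chart_dom c) (\<lambda>p. \<omega> c p v)"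
    and B: "\<And>n. B n \<in> sets borel" "\<And>n. B n \<subseteq> chart_dom c" "disjoint_family B"
  shows "(\<Sum>n. chart_integral \<omega> c (B n)) = chart_integral \<omega> c (\<Union>n. B n)"
proof -
  let ?V = "chart_map c ` chart_dom c"
  let ?\<mu> = "density lborel (\<lambda>y. ennreal (chart_density \<omega> c y * indicator ?V y))"
  have meas: "(\<lambda>y. chart_density \<omega> c y * indicator ?V y) \<in> borel_measurable borel"
    using c by (intro borel_measurable_chart_density c \<omega>) (auto simp: is_chart_def)
  have *: "chart_integral \<omega> c X = emeasure ?\<mu> (chart_map c ` X)"
    if "X \<in> sets borel" "X \<subseteq> chart_dom c" for X
  proof -
    have "emeasure ?\<mu> (chart_map c ` X) = (\<integral>\<^sup>+ y\<in>chart_map c ` X. ennreal (chart_density \<omega> c y * indicator ?V y) \<partial>lborel)"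
      using meas borel_chart_image[OF c that] by (intro emeasure_density) auto
    also have "\<dots> = chart_integral \<omega> c X"
      unfolding chart_integral_def using that by (intro nn_integral_cong) (auto simp: indicator_def)
    finally show ?thesis ..
  qed
  have "disjoint_family (\<lambda>n. chart_map c ` B n)"
    using B(2,3) inj_on_chart_map[OF c] unfolding disjoint_family_on_def inj_on_def by blast
  then have "(\<Sum>n. emeasure ?\<mu> (chart_map c ` B n)) = emeasure ?\<mu> (\<Union>n. chart_map c ` B n)"
    using borel_chart_image[OF c B(1,2)] by (intro suminf_emeasure) auto
  also have "(\<Union>n. chart_map c ` B n) = chart_map c ` (\<Union>n. B n)"
    by blast
  also have "emeasure ?\<mu> \<dots> = chart_integral \<omega> c (\<Union>n. B n)"
    using B by (intro *[symmetric]) auto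
  finally show ?thesis
    using B(1,2) by (simp add: *)
qed

text \<open>
The change of variables formula for the local representation of \<open>f\<close>: the pullback condition
makes the Jacobian determinant, in absolute value, the factor between the two densities.
\<close>

lemma chart_integral_image:
  fixes c c' :: "('a::topological_space, 'n::finite) chart"
  assumes c: "is_chart c" "is_chart c'"
    and \<omega>: "\<And>v. continuous_on (chart_dom c) (\<lambda>p. \<omega> c p v)" "\<And>v. continuous_on (chart_dom c') (\<lambda>p. \<omega> c' p v)"
    and alt: "\<And>p. p \<in> chart_dom c' \<Longrightarrow> alternating_form (\<omega> c' p)"
    and C1: "C1_on (chart_map c ` (chart_dom c \<inter> f -` chart_dom c')) (local_rep f c c')"
    and B: "B \<in> sets borel" "f ` B \<in> sets borel" "B \<subseteq> chart_dom c \<inter> f -` chart_dom c'"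
    and inj: "inj_on f B"
    and pullback: "\<And>p. p \<in> B \<Longrightarrow> pullback_rep f \<omega> c c' p = \<omega> c p"
  shows "chart_integral \<omega> c' (f ` B) = chart_integral \<omega> c B"
proof -
  let ?g = "local_rep f c c'" and ?S = "chart_map c ` B"
  have sub: "B \<subseteq> chart_dom c" "f ` B \<subseteq> chart_dom c'"
    using B(3) by auto
  have g: "?g (chart_map c p) = chart_map c' (f p)" if "p \<in> B" for p
    using that sub by (auto simp: local_rep_def chart_inv_chart_map[OF c(1)])
  then have gS: "?g ` ?S = chart_map c' ` f ` B"
    by (force simp: image_iff)
  obtain g' where g': "\<And>x. x \<in> chart_map c ` (chart_dom c \<inter> f -` chart_dom c') \<Longrightarrow> 
      (?g has_derivative blinfun_apply (g' x)) (at x)"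
    using C1 unfolding C1_on_def by blast
  have det: "\<bar>det (matrix (blinfun_apply (g' x)))\<bar> * chart_density \<omega> c' (?g x) = chart_density \<omega> c x"
    if "x \<in> ?S" for x
  proof -
    from that obtain p where p: "p \<in> B" and x: "x = chart_map c p" by blast
    have "blinfun_apply (g' x) = frechet_derivative ?g (at x)"
      using p x B(3) by (intro frechet_derivative_at g') auto
    then have "\<omega> c p (\<lambda>i. axis i 1) = \<omega> c' (f p) (\<lambda>i. blinfun_apply (g' x) (axis i 1))"
      using pullback[OF p] by (auto simp: pullback_rep_def x fun_eq_iff)
    also have "\<dots> = det (matrix (blinfun_apply (g' x))) * \<omega> c' (f p) (\<lambda>i. axis i 1)"
      using p sub by (intro alternating_form_linear_image_basis alt) auto
    finally show ?thesis
      using p sub by (auto simp: chart_density_def x g chart_inv_chart_map[OF c(1)] chart_inv_chart_map[OF c(2)]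
         subset_iff abs_mult)
  qed
  have "chart_integral \<omega> c' (f ` B) = (\<integral>\<^sup>+ y\<in>?g ` ?S. ennreal (chart_density \<omega> c' y) \<partial>lborel)"
    by (simp add: chart_integral_def gS)
  also have "\<dots> = (\<integral>\<^sup>+ x\<in>?S. ennreal (\<bar>det (matrix (blinfun_apply (g' x)))\<bar> * chart_density \<omega> c' (?g x)) \<partial>lborel)"
  proof (rule nn_integral_change_of_variables)
    show S: "?S \<in> sets borel" and gS': "?g ` ?S \<in> sets borel"
      unfolding gS using borel_chart_image[OF c(1) B(1) sub(1)] borel_chart_image[OF c(2) B(2) sub(2)] by auto
    show "(?g has_derivative blinfun_apply (g' x)) (at x within ?S)" if "x \<in> ?S" for x
    proof (rule has_derivative_at_withinI, rule g')
      show "x \<in> chart_map c ` (chart_dom c \<inter> f -` chart_dom c')"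
        using that B(3) by blast
    qed
    show "inj_on ?g ?S"
    proof (rule inj_onI, elim imageE, hypsubst)
      fix p q assume "p \<in> B" "q \<in> B" "?g (chart_map c p) = ?g (chart_map c q)"
      moreover from this have "f p = f q"
        using g sub(2) inj_onD[OF inj_on_chart_map[OF c(2)]] by (simp add: image_subset_iff)
      ultimately show "chart_map c p = chart_map c q"
        using inj_onD[OF inj] by blast
    qed
    show "(\<lambda>y. chart_density \<omega> c' y * indicator (?g ` ?S) y) \<in> borel_measurable borel"
      using gS' sub(2) by (intro borel_measurable_chart_density c \<omega>) (auto simp: gS)
    have "(\<lambda>x. chart_density \<omega> c x * indicator ?S x) \<in> borel_measurable borel"
      using S sub(1) by (intro borel_measurable_chart_density c \<omega>) auto
    also have "(\<lambda>x. chart_density \<omega> c x * indicator ?S x) =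
       (\<lambda>x. \<bar>det (matrix (blinfun_apply (g' x)))\<bar> * chart_density \<omega> c' (?g x) * indicator ?S x)"
      using det by (auto simp: indicator_def fun_eq_iff)
    finally show "(\<lambda>x. \<bar>det (matrix (blinfun_apply (g' x)))\<bar> * chart_density \<omega> c' (?g x) * indicator ?S x)
       \<in> borel_measurable borel" .
  qed (simp add: chart_density_def)
  also have "\<dots> = chart_integral \<omega> c B"
    unfolding chart_integral_def using det by (intro nn_integral_cong) (auto simp: indicator_def)
  finally show ?thesis .
qed

section \<open>The measure defined by a form\<close>

lemma bij_image_eq_vimage_inv: "bij f \<Longrightarrow> f ` X = inv f -` X"
  by (simp add: bij_vimage_eq_inv_image bij_imp_bij_inv inv_inv_eq)

lemma borel_image_bij:
  assumes "bij f" "continuous_on UNIV (inv f)" "X \<in> sets borel"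
  shows "f ` X \<in> sets borel"
  unfolding bij_image_eq_vimage_inv[OF assms(1)]
  using measurable_sets_borel[OF borel_measurable_continuous_onI[OF assms(2)] assms(3)] .

text \<open>
Any measurable set splits into countably many disjoint pieces, each inside one member of the cover.
\<close>

lemma measure_eqI_countable_cover:
  fixes W :: "nat \<Rightarrow> 'a set"
  assumes "sets \<mu> = sets \<nu>" and W: "\<And>n. W n \<in> sets \<mu>" "(\<Union>n. W n) = space \<mu>"
    and eq: "\<And>n B. B \<in> sets \<mu> \<Longrightarrow> B \<subseteq> W n \<Longrightarrow> emeasure \<mu> B = emeasure \<nu> B"
  shows "\<mu> = \<nu>"
proof (rule measure_eqI)
  fix B assume B: "B \<in> sets \<mu>"
  let ?P = "\<lambda>n. B \<inter> disjointed W n"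
  have P: "?P n \<in> sets \<mu>" "?P n \<in> sets \<nu>" for n
    using B W(1) assms(1) sets.range_disjointed_sets[of W \<mu>] by auto
  have "disjoint_family ?P"
    using disjoint_family_disjointed[of W] by (auto simp: disjoint_family_on_def)
  moreover have "(\<Union>n. ?P n) = B"
    using sets.sets_into_space[OF B] W(2) by (auto simp: UN_disjointed_eq simp flip: Int_UN_distrib)
  ultimately have "emeasure \<mu> B = (\<Sum>n. emeasure \<mu> (?P n))" "emeasure \<nu> B = (\<Sum>n. emeasure \<nu> (?P n))"
    using suminf_emeasure[of ?P \<mu>] suminf_emeasure[of ?P \<nu>] image_subsetI[of UNIV ?P, OF P(1)] image_subsetI[of UNIV ?P, OF P(2)] by auto
  moreover have "emeasure \<mu> (?P n) = emeasure \<nu> (?P n)" for n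
    using P disjointed_subset[of W n] by (intro eq[of _ n]) auto
  ultimately show "emeasure \<mu> B = emeasure \<nu> B"
    by simp
qed fact

lemma suminf_swap_ennreal:
  fixes a :: "nat \<Rightarrow> nat \<Rightarrow> ennreal"
  shows "(\<Sum>i. \<Sum>j. a i j) = (\<Sum>j. \<Sum>i. a i j)"
  using nn_integral_fst_count_space[of "\<lambda>(i, j). a i j"] nn_integral_snd_count_space[of "\<lambda>(i, j). a i j"]
  by (simp add: nn_integral_count_space_nat)

text \<open>
The condition of which the Borel volume measure is, by definition, the only solution. With a name
for it, existence and uniqueness can be shown separately.
\<close>

definition is_volume_measure :: "('a::topological_space, 'n::finite) chart set \<Rightarrow> ('a, 'n) nform \<Rightarrow> 'a measure \<Rightarrow> bool" where
  "is_volume_measure \<A> \<omega> \<mu> \<longleftrightarrow> sets \<mu> = sets borel \<and>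
     (\<forall>c\<in>\<A>. \<forall>B\<in>sets borel. B \<subseteq> chart_dom c \<longrightarrow> emeasure \<mu> B = chart_integral \<omega> c B)"

text \<open>
Compactness of the closed balls stands in for second countability: it provides the countable cover
by charts on which existence and uniqueness of the measure rest.
\<close>

locale nform_manifold =
  fixes \<A> :: "('a::metric_space, 'n::finite) chart set" and \<omega> :: "('a, 'n) nform"
  assumes compact_cball: "compact (cball (x :: 'a) r)"
    and atlas: "C1_atlas \<A>"
    and is_nform: "is_nform \<A> \<omega>"
begin

lemma is_chart: "c \<in> \<A> \<Longrightarrow> is_chart c"
  using atlas by (simp add: C1_atlas_def)

lemma open_chart_dom: "c \<in> \<A> \<Longrightarrow> open (chart_dom c)"
  using is_chart by (simp add: is_chart_def)

lemma continuous_on_form: "c \<in> \<A> \<Longrightarrow> continuous_on (chart_dom c) (\<lambda>p. \<omega> c p v)"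
  using is_nform unfolding is_nform_def by blast

lemma alternating_form_at: "c \<in> \<A> \<Longrightarrow> p \<in> chart_dom c \<Longrightarrow> alternating_form (\<omega> c p)"
  using is_nform unfolding is_nform_def by blast

text \<open>
The space is the union of the closed balls of integer radius about a point, and each of them
is compact, so finitely many charts cover it.
\<close>

lemma countable_chart_cover:
  obtains c :: "nat \<Rightarrow> ('a, 'n) chart" where "\<And>n. c n \<in> \<A>" "(\<Union>n. chart_dom (c n)) = UNIV"
proof -
  have cover: "(\<Union>c\<in>\<A>. chart_dom c) = UNIV"
    using atlas by (simp add: C1_atlas_def)
  \<comment> \<open>Any point serves as the centre of the balls.\<close>
  define x0 :: 'a where "x0 = undefined"
  have "\<exists>C\<subseteq>\<A>. finite C \<and> cball x0 (real n) \<subseteq> (\<Union>c\<in>C. chart_dom c)" for n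
    by (rule compactE_image[OF compact_cball, of \<A> chart_dom x0 "real n"])
       (use open_chart_dom cover in auto)
  then obtain C where C: "\<And>n. C n \<subseteq> \<A>" "\<And>n. finite (C n)" 
      "\<And>n::nat. cball x0 (real n) \<subseteq> (\<Union>c\<in>C n. chart_dom c)"
    by metis
  let ?C = "\<Union>n. C n"
  have "x \<in> (\<Union>c\<in>?C. chart_dom c)" for x
  proof -
    obtain n where "dist x0 x \<le> real n"
      using real_arch_simple by blast
    then show ?thesis
      using C(3)[of n] by (auto simp: subset_iff) blast
  qed
  then have UN: "(\<Union>c\<in>?C. chart_dom c) = UNIV"
    by blast
  then have "?C \<noteq> {}"
    by blast
  moreover have "countable ?C"
    using C(2) by (simp add: countable_finite)
  ultimately have range: "range (from_nat_into ?C) = ?C"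
    by (rule range_from_nat_into)
  show ?thesis
  proof (rule that)
    show "from_nat_into ?C n \<in> \<A>" for n
      using rangeI[of "from_nat_into ?C" n] C(1) unfolding range by blast
    have "(\<Union>n. chart_dom (from_nat_into ?C n)) = \<Union> (chart_dom ` range (from_nat_into ?C))"
      by (simp only: image_image)
    then show "(\<Union>n. chart_dom (from_nat_into ?C n)) = UNIV"
      unfolding range UN .
  qed
qed

lemma volume_measure_unique:
  assumes "is_volume_measure \<A> \<omega> \<mu>" "is_volume_measure \<A> \<omega> \<nu>"
  shows "\<mu> = \<nu>"
proof -
  obtain c :: "nat \<Rightarrow> ('a, 'n) chart" where c: "\<And>n. c n \<in> \<A>" "(\<Union>n. chart_dom (c n)) = UNIV"
    by (rule countable_chart_cover) blast
  have sets: "sets \<mu> = sets borel" "sets \<nu> = sets borel"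
    using assms by (simp_all add: is_volume_measure_def)
  show ?thesis
  proof (rule measure_eqI_countable_cover[where W = "\<lambda>n. chart_dom (c n)"])
    show "(\<Union>n. chart_dom (c n)) = space \<mu>"
      using c(2) sets_eq_imp_space_eq[OF sets(1)] by simp
    show "chart_dom (c n) \<in> sets \<mu>" for n
      using open_chart_dom[OF c(1)] by (simp add: sets(1))
    show "emeasure \<mu> B = emeasure \<nu> B" if "B \<in> sets \<mu>" "B \<subseteq> chart_dom (c n)" for n B
      using that assms c(1)[of n] unfolding is_volume_measure_def by (metis (no_types))
  qed (simp add: sets)
qed

lemma chart_integral_change_of_chart:
  assumes c: "c \<in> \<A>" "c' \<in> \<A>" and B: "B \<in> sets borel" "B \<subseteq> chart_dom c" "B \<subseteq> chart_dom c'"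
  shows "chart_integral \<omega> c' B = chart_integral \<omega> c B"
proof -
  have "pullback_rep id \<omega> c c' p = \<omega> c p" if "p \<in> B" for p
  proof -
    have "\<forall>c\<in>\<A>. \<forall>c'\<in>\<A>. \<forall>p\<in>chart_dom c \<inter> chart_dom c'. \<omega> c p = pullback_rep id \<omega> c c' p"
      using is_nform unfolding is_nform_def by (elim conjE)
    moreover have "p \<in> chart_dom c \<inter> chart_dom c'"
      using that B by blast
    ultimately show ?thesis
      using c by metis
  qed
  moreover have "C1_on (chart_map c ` (chart_dom c \<inter> id -` chart_dom c')) (local_rep id c c')"
    using atlas c by (simp add: C1_atlas_def)
  ultimately have "chart_integral \<omega> c' (id ` B) = chart_integral \<omega> c B"
    using c B by (intro chart_integral_image is_chart continuous_on_form alternating_form_at) auto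
  then show ?thesis by simp
qed

text \<open>
The charts of a countable cover are made disjoint, and the integrals over the resulting
pieces are added up. By \<open>chart_integral_change_of_chart\<close> the result agrees, on any chart of
the atlas, with the integral in that chart.
\<close>

lemma volume_measure_exists:
  "\<exists>\<mu>. is_volume_measure \<A> \<omega> \<mu>"
proof -
  obtain c :: "nat \<Rightarrow> ('a, 'n) chart" where c: "\<And>n. c n \<in> \<A>" "(\<Union>n. chart_dom (c n)) = UNIV"
    by (rule countable_chart_cover) blast
  define P where "P = disjointed (\<lambda>n. chart_dom (c n))"
  have P: "P n \<in> sets borel" "P n \<subseteq> chart_dom (c n)" for n
  proof -
    have "range (\<lambda>n. chart_dom (c n)) \<subseteq> sets borel"
      using open_chart_dom[OF c(1)] by (intro image_subsetI borel_open)
    from sets.range_disjointed_sets[OF this] show "P n \<in> sets borel"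
      unfolding P_def by (rule range_subsetD)
    show "P n \<subseteq> chart_dom (c n)"
      unfolding P_def by (rule disjointed_subset)
  qed
  have P_disj: "disjoint_family P"
    unfolding P_def by (rule disjoint_family_disjointed)
  have P_cover: "(\<Union>n. P n) = UNIV"
    unfolding P_def by (rule trans[OF UN_disjointed_eq c(2)])
  define m where "m B = (\<Sum>n. chart_integral \<omega> (c n) (B \<inter> P n))" for B
  define \<mu> where "\<mu> = measure_of UNIV (sets borel) m"
  have sets: "sets \<mu> = sets borel"
    using sets.sigma_sets_eq[of "borel :: 'a measure"] by (simp add: \<mu>_def)
  have "countably_additive (sets borel) m"
    unfolding countably_additive_def
  proof safe
    fix B :: "nat \<Rightarrow> 'a set"
    assume B: "range B \<subseteq> sets borel" "disjoint_family B"
    have "chart_integral \<omega> (c n) ((\<Union>k. B k) \<inter> P n) = (\<Sum>k. chart_integral \<omega> (c n) (B k \<inter> P n))" for n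
    proof -
      have "disjoint_family (\<lambda>k. B k \<inter> P n)"
        using B(2) by (auto simp: disjoint_family_on_def)
      then have "(\<Sum>k. chart_integral \<omega> (c n) (B k \<inter> P n)) = chart_integral \<omega> (c n) (\<Union>k. B k \<inter> P n)"
        using B(1) P by (intro suminf_chart_integral is_chart continuous_on_form c) auto
      then show ?thesis by simp
    qed
    then show "(\<Sum>k. m (B k)) = m (\<Union>k. B k)"
      unfolding m_def by (simp only: suminf_swap_ennreal[of "\<lambda>k n. chart_integral \<omega> (c n) (B k \<inter> P n)"])
  qed
  moreover have "positive (sets borel) m"
    by (simp add: positive_def m_def chart_integral_def)
  ultimately have emeasure: "emeasure \<mu> B = m B" if "B \<in> sets borel" for B
    using that sets.sigma_algebra_axioms[of "borel :: 'a measure"]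
    unfolding \<mu>_def by (intro emeasure_measure_of_sigma) auto
  have "emeasure \<mu> B = chart_integral \<omega> c' B" if c': "c' \<in> \<A>" and B: "B \<in> sets borel" "B \<subseteq> chart_dom c'" for c' B
  proof -
    have "chart_integral \<omega> (c n) (B \<inter> P n) = chart_integral \<omega> c' (B \<inter> P n)" for n
      using B P[of n] by (intro chart_integral_change_of_chart c c') auto
    then have "emeasure \<mu> B = (\<Sum>n. chart_integral \<omega> c' (B \<inter> P n))"
      by (simp add: emeasure[OF B(1)] m_def)
    also have "\<dots> = chart_integral \<omega> c' (\<Union>n. B \<inter> P n)"
    proof (intro suminf_chart_integral is_chart continuous_on_form c')
      show "disjoint_family (\<lambda>n. B \<inter> P n)"
        using P_disj unfolding disjoint_family_on_def by blast
    qed (use B P in auto)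
    also have "(\<Union>n. B \<inter> P n) = B"
      using P_cover by auto
    finally show ?thesis .
  qed
  then show ?thesis
    using sets by (auto simp: is_volume_measure_def)
qed

lemma is_volume_measure_borel_volume_measure:
  "is_volume_measure \<A> \<omega> (borel_volume_measure \<A> \<omega>)"
proof -
  have "borel_volume_measure \<A> \<omega> = (THE \<mu>. is_volume_measure \<A> \<omega> \<mu>)"
    by (simp add: borel_volume_measure_def is_volume_measure_def chart_integral_def chart_density_def)
  moreover have "\<exists>!\<mu>. is_volume_measure \<A> \<omega> \<mu>"
    using volume_measure_exists volume_measure_unique by blast
  ultimately show ?thesis
    by (simp add: theI')
qed

lemma sets_volume [simp, measurable_cong]: "sets (borel_volume_measure \<A> \<omega>) = sets borel"
  using is_volume_measure_borel_volume_measure by (simp add: is_volume_measure_def)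

lemma emeasure_volume_chart:
  "c \<in> \<A> \<Longrightarrow> B \<in> sets borel \<Longrightarrow> B \<subseteq> chart_dom c \<Longrightarrow> 
     emeasure (borel_volume_measure \<A> \<omega>) B = chart_integral \<omega> c B"
  using is_volume_measure_borel_volume_measure by (simp add: is_volume_measure_def)

text \<open>
The two measures \<open>B \<mapsto> \<mu> B\<close> and \<open>B \<mapsto> \<mu> (f ` B)\<close> agree on sets that are contained in one chart and
whose image is contained in one chart. Countably many such sets cover the space, so
\<open>measure_eqI_countable_cover\<close> applies.
\<close>

lemma emeasure_volume_image:
  assumes f: "C1_diffeomorphism \<A> f" and pres: "preserves_form \<A> f \<omega>" and B: "B \<in> sets borel"
  shows "emeasure (borel_volume_measure \<A> \<omega>) (f ` B) = emeasure (borel_volume_measure \<A> \<omega>) B"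
proof -
  let ?\<mu> = "borel_volume_measure \<A> \<omega>"
  have bij: "bij f" and cont: "continuous_on UNIV f" "continuous_on UNIV (inv f)"
    using f by (auto simp: C1_diffeomorphism_def C1_map_def)
  have [measurable]: "f \<in> borel_measurable borel" "inv f \<in> borel_measurable borel"
    using cont by (auto intro: borel_measurable_continuous_onI)
  note image = bij_image_eq_vimage_inv[OF bij] and borel_image = borel_image_bij[OF bij cont(2)]
  obtain c :: "nat \<Rightarrow> ('a, 'n) chart" where c: "\<And>n. c n \<in> \<A>" "(\<Union>n. chart_dom (c n)) = UNIV"
    by (rule countable_chart_cover) blast
  let ?W = "\<lambda>k. case prod_decode k of (i, j) \<Rightarrow> chart_dom (c i) \<inter> f -` chart_dom (c j)"
  have "?\<mu> = distr ?\<mu> borel (inv f)"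
  proof (rule measure_eqI_countable_cover[where W = ?W])
    have "open (f -` chart_dom (c j))" for j
      using cont(1) open_chart_dom[OF c(1)] by (simp add: continuous_on_open_vimage)
    then show "?W k \<in> sets ?\<mu>" for k
      using open_chart_dom[OF c(1)] by (auto split: prod.split)
    have "x \<in> (\<Union>k. ?W k)" for x
    proof -
      obtain i j where "x \<in> chart_dom (c i)" "f x \<in> chart_dom (c j)"
        using c(2) by blast
      then have "x \<in> ?W (prod_encode (i, j))"
        by simp
      then show ?thesis
        by (rule UN_I[OF UNIV_I])
    qed
    then have "(\<Union>k. ?W k) = UNIV"
      by blast
    then show "(\<Union>k. ?W k) = space ?\<mu>"
      using sets_eq_imp_space_eq[OF sets_volume] by simp
    fix k and X assume X: "X \<in> sets ?\<mu>" "X \<subseteq> ?W k"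
    obtain i j where "prod_decode k = (i, j)"
      by fastforce
    with X have X': "X \<in> sets borel" "X \<subseteq> chart_dom (c i) \<inter> f -` chart_dom (c j)"
      by auto
    have "emeasure (distr ?\<mu> borel (inv f)) X = emeasure ?\<mu> (f ` X)"
      using X' sets_eq_imp_space_eq[OF sets_volume] by (subst emeasure_distr) (auto simp: image)
    also have "\<dots> = chart_integral \<omega> (c j) (f ` X)"
      using X' borel_image by (intro emeasure_volume_chart c) auto
    also have "\<dots> = chart_integral \<omega> (c i) X"
    proof (rule chart_integral_image)
      show "C1_on (chart_map (c i) ` (chart_dom (c i) \<inter> f -` chart_dom (c j))) (local_rep f (c i) (c j))"
        using f c(1) by (simp add: C1_diffeomorphism_def C1_map_def)
      show "inj_on f X"
        using bij by (auto simp: bij_def inj_on_def)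
      show "pullback_rep f \<omega> (c i) (c j) p = \<omega> (c i) p" if "p \<in> X" for p
        using pres c(1) X'(2) that unfolding preserves_form_def by blast
    qed (use X' borel_image c(1) is_chart continuous_on_form alternating_form_at in auto)
    also have "\<dots> = emeasure ?\<mu> X"
      using X' by (intro emeasure_volume_chart[symmetric] c) auto
    finally show "emeasure ?\<mu> X = emeasure (distr ?\<mu> borel (inv f)) X" ..
  qed simp
  then have "emeasure ?\<mu> B = emeasure (distr ?\<mu> borel (inv f)) B"
    by simp
  also have "\<dots> = emeasure ?\<mu> (f ` B)"
    using B sets_eq_imp_space_eq[OF sets_volume] by (subst emeasure_distr) (auto simp: image)
  finally show ?thesis ..
qed

text \<open>
Every point has a neighbourhood on which the density is bounded and which its chart maps into a ball,
so that the neighbourhood has finite measure.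
\<close>

lemma emeasure_volume_compact:
  assumes "compact K"
  shows "emeasure (borel_volume_measure \<A> \<omega>) K < \<infinity>"
proof -
  let ?\<mu> = "borel_volume_measure \<A> \<omega>"
  have "\<exists>V. open V \<and> p \<in> V \<and> emeasure ?\<mu> V < \<infinity>" for p
  proof -
    obtain c where c: "c \<in> \<A>" "p \<in> chart_dom c"
      using atlas unfolding C1_atlas_def by blast
    note chart = is_chart[OF c(1)]
    let ?h = "\<lambda>q. \<bar>\<omega> c q (\<lambda>i. axis i 1)\<bar>" and ?D = "chart_dom c"
    obtain K where K: "?h p < K"
      using gt_ex by blast
    define V where "V = (chart_dom c \<inter> ?h -` {..<K}) \<inter> (chart_dom c \<inter> chart_map c -` ball (chart_map c p) 1)"
    have D: "open ?D"
      using open_chart_dom c by simp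
    have "continuous_on ?D ?h"
      by (intro continuous_intros continuous_on_form c)
    moreover have "continuous_on ?D (chart_map c)"
      using chart by (simp add: is_chart_def homeomorphism_def)
    ultimately have V: "open V"
      unfolding V_def by (intro open_Int continuous_open_preimage D) auto
    have V_sub: "V \<subseteq> ?D"
      by (auto simp: V_def)
    have "emeasure ?\<mu> V = chart_integral \<omega> c V"
      using V V_sub by (intro emeasure_volume_chart c) auto
    also have "\<dots> \<le> (\<integral>\<^sup>+ y. ennreal K * indicator (ball (chart_map c p) 1) y \<partial>lborel)"
      unfolding chart_integral_def chart_density_def
      by (intro nn_integral_mono)
         (auto simp: V_def indicator_def chart_inv_chart_map[OF chart] intro!: ennreal_leI)
    also have "\<dots> = ennreal K * emeasure lborel (ball (chart_map c p) 1)"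
      by (simp add: nn_integral_cmult_indicator)
    also have "\<dots> < \<infinity>"
      using emeasure_bounded_finite[OF bounded_ball, of "chart_map c p" 1]
      by (simp add: ennreal_mult_less_top)
    finally show ?thesis
      using V c(2) K by (intro exI[of _ V]) (auto simp: V_def)
  qed
  then obtain V where V: "\<And>p. open (V p)" "\<And>p. p \<in> V p" "\<And>p. emeasure ?\<mu> (V p) < \<infinity>"
    by metis
  obtain F where F: "F \<subseteq> K" "finite F" "K \<subseteq> (\<Union>p\<in>F. V p)"
    using compactE_image[OF assms, of K V] V(1,2) by (metis UN_I subsetI)
  have "emeasure ?\<mu> K \<le> emeasure ?\<mu> (\<Union>p\<in>F. V p)"
    using F(2,3) V(1) by (intro emeasure_mono) auto
  also have "\<dots> \<le> (\<Sum>p\<in>F. emeasure ?\<mu> (V p))"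
    using F(2) V(1) by (intro emeasure_subadditive_finite) auto
  also have "\<dots> < \<infinity>"
    using F(2) V(3) by (simp add: ennreal_sum_less_top)
  finally show ?thesis .
qed

end

section \<open>Wandering sets\<close>

text \<open>
If \<open>z n \<in> f ` U\<close> tends to \<open>y\<close>, then by continuity the radii \<open>\<epsilon> (z n)\<close> tend to \<open>\<epsilon> y > 0\<close> while
the distances to \<open>y\<close> tend to \<open>0\<close>. So \<open>y\<close> lies in one of the balls that are contained in \<open>U\<close>.
\<close>

lemma attractor_block_closure_image:
  fixes f :: "'a::metric_space \<Rightarrow> 'a"
  assumes "attractor_block f U"
  shows "closure (f ` U) \<subseteq> U"
proof
  fix y assume y: "y \<in> closure (f ` U)"
  obtain \<epsilon> :: "'a \<Rightarrow> real" where \<epsilon>: "continuous_on UNIV \<epsilon>" "\<And>x. \<epsilon> x > 0" 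
      "\<And>x. x \<in> U \<Longrightarrow> cball (f x) (\<epsilon> (f x)) \<subseteq> U"
    using assms unfolding attractor_block_def by blast
  obtain z where z: "\<And>n. z n \<in> f ` U" "z \<longlonglongrightarrow> y"
    using y unfolding closure_sequential by blast
  have "(\<lambda>n. \<epsilon> (z n) - dist (z n) y) \<longlonglongrightarrow> \<epsilon> y - dist y y"
    using \<epsilon>(1) z(2) by (intro tendsto_intros continuous_on_tendsto_compose[OF \<epsilon>(1)]) auto
  then have "\<forall>\<^sub>F n in sequentially. 0 < \<epsilon> (z n) - dist (z n) y"
    by (rule order_tendstoD(1)) (simp add: \<epsilon>(2))
  then obtain n where "dist (z n) y < \<epsilon> (z n)"
    unfolding eventually_sequentially by auto
  then show "y \<in> U"
    using z(1)[of n] \<epsilon>(3) by (force simp: subset_iff)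
qed

text \<open>
The image of a closed set is closed, being its preimage under the continuous map \<open>inv f\<close>.
\<close>

lemma closure_funpow_image_subset:
  fixes f :: "'a::topological_space \<Rightarrow> 'a"
  assumes "continuous_on UNIV (inv f)" "bij f"
  shows "closure ((f ^^ n) ` S) \<subseteq> (f ^^ n) ` closure S"
proof (induction n)
  case (Suc n)
  have *: "closure (f ` T) \<subseteq> f ` closure T" for T
  proof (rule closure_minimal)
    show "closed (f ` closure T)"
      using assms(1) by (simp add: bij_image_eq_vimage_inv[OF assms(2)] continuous_on_closed_vimage)
  qed (simp add: closure_subset image_mono)
  have "closure ((f ^^ Suc n) ` S) \<subseteq> f ` closure ((f ^^ n) ` S)"
    using *[of "(f ^^ n) ` S"] by (simp add: image_comp)
  also have "\<dots> \<subseteq> (f ^^ Suc n) ` closure S"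
    using Suc by (auto simp flip: image_comp)
  finally show ?case .
qed simp

lemma image_funpow_Suc: "(f ^^ Suc n) ` S = (f ^^ n) ` f ` S"
  by (simp only: funpow_Suc_right image_comp)

text \<open>
The images and their closures interleave: the closure of one image lies in the image before it.
\<close>

lemma attractor_eq_Inter_images:
  fixes f :: "'a::metric_space \<Rightarrow> 'a"
  assumes f: "continuous_on UNIV (inv f)" "bij f" and U: "attractor_block f U"
  shows "attractor f U = (\<Inter>n. (f ^^ n) ` U)"
proof -
  have *: "closure ((f ^^ Suc n) ` U) \<subseteq> (f ^^ n) ` U" for n
    using closure_funpow_image_subset[OF f, of n "f ` U"] attractor_block_closure_image[OF U]
    unfolding image_funpow_Suc by blast
  show ?thesis
    unfolding attractor_def
  proof (intro equalityI INT_greatest)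
    show "(\<Inter>n. closure ((f ^^ n) ` U)) \<subseteq> (f ^^ n) ` U" for n
      using INT_lower[OF UNIV_I] * by (rule order_trans)
    show "(\<Inter>n. (f ^^ n) ` U) \<subseteq> closure ((f ^^ n) ` U)" for n
      using INT_lower[OF UNIV_I] closure_subset by (rule order_trans)
  qed
qed

text \<open>
A point of \<open>U\<close> outside the intersection leaves the decreasing sequence of iterated images at a
definite index.
\<close>

lemma iterated_image_differences:
  assumes inj: "inj f" and sub: "f ` U \<subseteq> U"
  shows "U - (\<Inter>n. (f ^^ n) ` U) = (\<Union>n. (f ^^ n) ` (U - f ` U))"
    and "disjoint_family (\<lambda>n. (f ^^ n) ` (U - f ` U))"
proof -
  have injn: "inj (f ^^ n)" for n
    using inj by (rule inj_fn)
  have diff: "(f ^^ n) ` (U - f ` U) = (f ^^ n) ` U - (f ^^ Suc n) ` U" for n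
    unfolding image_funpow_Suc by (rule image_set_diff[OF injn])
  have "(f ^^ Suc n) ` U \<subseteq> (f ^^ n) ` U" for n
    unfolding image_funpow_Suc using sub by (rule image_mono)
  then have dec: "(f ^^ n) ` U \<subseteq> (f ^^ m) ` U" if "m \<le> n" for m n
    by (rule lift_Suc_antimono_le) (fact that)
  show "U - (\<Inter>n. (f ^^ n) ` U) = (\<Union>n. (f ^^ n) ` (U - f ` U))"
  proof (intro equalityI subsetI)
    fix x assume x: "x \<in> U - (\<Inter>n. (f ^^ n) ` U)"
    then obtain n where "x \<notin> (f ^^ n) ` U" "\<And>m. m < n \<Longrightarrow> x \<in> (f ^^ m) ` U"
      using exists_least_iff[of "\<lambda>n. x \<notin> (f ^^ n) ` U"] by blast
    moreover from this x have "n \<noteq> 0"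
      by (cases n) auto
    ultimately have "x \<in> (f ^^ (n - 1)) ` U - (f ^^ Suc (n - 1)) ` U"
      by simp
    then show "x \<in> (\<Union>n. (f ^^ n) ` (U - f ` U))"
      unfolding diff by blast
  next
    fix x assume "x \<in> (\<Union>n. (f ^^ n) ` (U - f ` U))"
    then obtain n where "x \<in> (f ^^ n) ` U" "x \<notin> (f ^^ Suc n) ` U"
      unfolding diff by blast
    moreover have "(f ^^ n) ` U \<subseteq> U"
      using dec[of 0 n] by simp
    ultimately show "x \<in> U - (\<Inter>n. (f ^^ n) ` U)"
      by blast
  qed
  show "disjoint_family (\<lambda>n. (f ^^ n) ` (U - f ` U))"
    unfolding diff disjoint_family_on_def
  proof (intro ballI impI)
    fix m n :: nat assume "m \<noteq> n"
    then have "Suc m \<le> n \<or> Suc n \<le> m"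
      by linarith
    then show "((f ^^ m) ` U - (f ^^ Suc m) ` U) \<inter> ((f ^^ n) ` U - (f ^^ Suc n) ` U) = {}"
      using dec[of "Suc m" n] dec[of "Suc n" m] by blast
  qed
qed

text \<open>
The iterated images of \<open>E\<close> are disjoint, have equal measure and fit together into \<open>K\<close>. A constant
series with a finite sum is zero.
\<close>

lemma wandering_set_confined_null:
  fixes f :: "'a::topological_space \<Rightarrow> 'a"
  assumes f: "continuous_on UNIV (inv f)" "bij f"
    and sets: "sets \<mu> = sets borel"
    and pres: "\<And>B. B \<in> sets borel \<Longrightarrow> emeasure \<mu> (f ` B) = emeasure \<mu> B"
    and E: "E \<in> sets borel" "disjoint_family (\<lambda>k. (f ^^ k) ` E)"
    and K: "K \<in> sets borel" "emeasure \<mu> K < \<infinity>" "\<And>k. (f ^^ k) ` E \<subseteq> K"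
  shows "E \<in> null_sets \<mu>"
proof -
  have iter: "(f ^^ k) ` E \<in> sets borel \<and> emeasure \<mu> ((f ^^ k) ` E) = emeasure \<mu> E" for k
  proof (induction k)
    case (Suc k)
    have "(f ^^ Suc k) ` E = f ` (f ^^ k) ` E"
      by (simp add: image_comp)
    then show ?case
      using Suc borel_image_bij[OF f(2,1)] pres by simp
  qed (simp add: E)
  have "(\<Sum>k::nat. emeasure \<mu> E) = (\<Sum>k. emeasure \<mu> ((f ^^ k) ` E))"
    using iter by simp
  also have "\<dots> = emeasure \<mu> (\<Union>k. (f ^^ k) ` E)"
    using iter E(2) by (intro suminf_emeasure) (auto simp: sets)
  also have "\<dots> \<le> emeasure \<mu> K"
    using K by (intro emeasure_mono) (auto simp: sets)
  also have "\<dots> < \<infinity>"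
    by (rule K)
  finally have fin: "(\<Sum>k::nat. emeasure \<mu> E) < \<infinity>" .
  then have "emeasure \<mu> E < \<infinity>"
    by (rule ennreal_suminf_lessD)
  then obtain e where e: "0 \<le> e" "emeasure \<mu> E = ennreal e"
    by (cases "emeasure \<mu> E" rule: ennreal_cases) auto
  have "summable (\<lambda>k::nat. e)"
    using fin e by (intro summable_suminf_not_top) auto
  then have "e = 0"
    using summable_LIMSEQ_zero LIMSEQ_const_iff by blast
  then have "emeasure \<mu> E = 0"
    using e by simp
  then show ?thesis
    using E sets by (simp add: null_sets_def)
qed

text \<open>
Countably many layers and countably many balls reduce this to the preceding lemma.
\<close>

lemma bounded_orbit_wandering_null:
  fixes f :: "'a::metric_space \<Rightarrow> 'a"
  assumes f: "continuous_on UNIV f" "continuous_on UNIV (inv f)" "bij f"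
    and sets: "sets \<mu> = sets borel"
    and pres: "\<And>B. B \<in> sets borel \<Longrightarrow> emeasure \<mu> (f ` B) = emeasure \<mu> B"
    and finite: "\<And>x r. emeasure \<mu> (cball x r) < \<infinity>"
    and W: "W \<in> sets borel" "disjoint_family (\<lambda>n. (f ^^ n) ` W)"
  shows "{p \<in> (\<Union>n. (f ^^ n) ` W). bounded (forward_orbit f p)} \<in> null_sets \<mu>"
proof -
  have iter: "(f ^^ n) ` W \<in> sets borel" for n
  proof (induction n)
    case (Suc n)
    from borel_image_bij[OF f(3,2) this] show ?case
      by (simp add: image_comp)
  qed (simp add: W)
  \<comment> \<open>The balls need a common centre; any point will do.\<close>
  define x0 :: 'a where "x0 = undefined"
  define E where "E n r = {p \<in> (f ^^ n) ` W. \<forall>k. (f ^^ k) p \<in> cball x0 (real r)}" for n r :: nat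
  have null: "E n r \<in> null_sets \<mu>" for n r
  proof (rule wandering_set_confined_null[OF f(2,3) sets pres])
    have cont: "continuous_on UNIV (f ^^ k)" for k
      by (induction k) (auto intro: continuous_on_compose2[OF f(1)] simp: continuous_on_id id_def)
    have "E n r = (f ^^ n) ` W \<inter> (\<Inter>k. (f ^^ k) -` cball x0 (real r))"
      by (auto simp: E_def)
    moreover have "(f ^^ k) -` cball x0 (real r) \<in> sets borel" for k
      by (rule measurable_sets_borel[OF borel_measurable_continuous_onI[OF cont]]) simp
    ultimately show "E n r \<in> sets borel"
      using iter by auto
    have sub: "(f ^^ k) ` E n r \<subseteq> (f ^^ (k + n)) ` W" for k
      by (auto simp: E_def funpow_add)
    show "disjoint_family (\<lambda>k. (f ^^ k) ` E n r)"
      unfolding disjoint_family_on_def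
    proof (intro ballI impI)
      fix k l :: nat assume "k \<noteq> l"
      then have "(f ^^ (k + n)) ` W \<inter> (f ^^ (l + n)) ` W = {}"
        using disjoint_family_onD[OF W(2), of "k + n" "l + n"] by simp
      then show "(f ^^ k) ` E n r \<inter> (f ^^ l) ` E n r = {}"
        using sub[of k] sub[of l] by blast
    qed
    show "(f ^^ k) ` E n r \<subseteq> cball x0 (real r)" for k
      by (auto simp: E_def)
    show "cball x0 (real r) \<in> sets borel"
      by simp
  qed (assumption | rule finite)+
  have "(\<Union>r. E n r) \<in> null_sets \<mu>" for n
    using null by (rule null_sets_UN)
  then have union: "(\<Union>n. \<Union>r. E n r) \<in> null_sets \<mu>"
    by (rule null_sets_UN)
  have eq: "(\<Union>n. \<Union>r. E n r) = {p \<in> (\<Union>n. (f ^^ n) ` W). bounded (forward_orbit f p)}"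
  proof -
    have bounded: "bounded (forward_orbit f p) \<longleftrightarrow> (\<exists>r::nat. \<forall>k. (f ^^ k) p \<in> cball x0 (real r))" for p
    proof
      assume "bounded (forward_orbit f p)"
      then obtain e where "\<forall>y\<in>forward_orbit f p. dist x0 y \<le> e"
        unfolding bounded_any_center[where a = x0] by (elim exE)
      then have e: "dist x0 ((f ^^ k) p) \<le> e" for k
        by (auto simp: forward_orbit_def)
      obtain r :: nat where "e \<le> real r"
        using real_arch_simple by blast
      then show "\<exists>r::nat. \<forall>k. (f ^^ k) p \<in> cball x0 (real r)"
        using order_trans[OF e] unfolding mem_cball by (intro exI[of _ r] allI)
    next
      assume "\<exists>r::nat. \<forall>k. (f ^^ k) p \<in> cball x0 (real r)"
      then show "bounded (forward_orbit f p)"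
        by (elim exE) (rule bounded_subset[OF bounded_cball], auto simp: forward_orbit_def)
    qed
    show ?thesis
      unfolding E_def bounded set_eq_iff UN_iff mem_Collect_eq by blast
  qed
  show ?thesis
    using union unfolding eq .
qed

section \<open>Bounded orbits outside the attractor\<close>

theorem proposition4p9:
  fixes \<A> :: "('a::metric_space, 'n::finite) chart set"
    and \<omega> :: "('a, 'n) nform"
    and f :: "'a \<Rightarrow> 'a"
    and U A :: "'a set"
  assumes "\<And>(x::'a) r. compact (cball x r)"
    and "C1_atlas \<A>"
    and "volume_form \<A> \<omega>"
    and "C1_diffeomorphism \<A> f"
    and "preserves_form \<A> f \<omega>"
    and "attractor_block f U"
    and "A = attractor f U"
  shows "(U - A) - {p \<in> U - A. \<not> bounded (forward_orbit f p)} \<in> null_sets (volume_measure \<A> \<omega>)"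
proof -
  interpret nform_manifold \<A> \<omega>
    by (rule nform_manifold.intro[OF assms(1,2)]) (use assms(3) in \<open>simp add: volume_form_def\<close>)
  let ?\<mu> = "borel_volume_measure \<A> \<omega>" and ?W = "U - f ` U"
  have f: "continuous_on UNIV f" "continuous_on UNIV (inv f)" "bij f"
    using assms(4) by (auto simp: C1_diffeomorphism_def C1_map_def)
  have sub: "f ` U \<subseteq> U"
    using attractor_block_closure_image[OF assms(6)] closure_subset by blast
  note iterates = iterated_image_differences[OF bij_is_inj[OF f(3)] sub]
  have U_diff_A: "U - A = (\<Union>n. (f ^^ n) ` ?W)"
    unfolding assms(7) attractor_eq_Inter_images[OF f(2,3) assms(6)] by (rule iterates(1))
  have U: "U \<in> sets borel"
    using assms(6) by (simp add: attractor_block_def)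
  then have W: "?W \<in> sets borel"
    by (intro sets.Diff borel_image_bij f)
  have null: "{p \<in> U - A. bounded (forward_orbit f p)} \<in> null_sets ?\<mu>"
    unfolding U_diff_A
    by (rule bounded_orbit_wandering_null[OF f sets_volume emeasure_volume_image[OF assms(4,5)]
          emeasure_volume_compact[OF compact_cball] W iterates(2)])
  have eq: "(U - A) - {p \<in> U - A. \<not> bounded (forward_orbit f p)} = {p \<in> U - A. bounded (forward_orbit f p)}"
    by blast
  show ?thesis
    unfolding eq volume_measure_def using null by (rule null_sets_completionI)
qed

end
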